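(* Let $n\ge2$ be an integer, $k>0$, and let $\phi,\eta,p,q\in\mathbb{R}^n$ with $\phi,\ \eta,\ p,\ q-p\in(0,\infty)^n$, and $\zeta\in[0,\infty)^n$. Then $$\frac{\beta_{\zeta,k}^{(p,q)}(\phi;\eta)}{\beta_k(\phi;\eta)}\ \ge\ \prod_{i=1}^n {}_1F_{1,k}\!\left(p_i;q_i;-\frac{\zeta_i^k}{\eta_i^k}\right).$$
   Context: $E_{n-1}=\{(t_1,\dots,t_{n-1})\in\mathbb{R}^{n-1}: t_i\ge 0,\ \sum_{i=1}^{n-1}t_i\le 1\}$; for $t\in E_{n-1}$ put $t_n=1-\sum_{i=1}^{n-1}t_i$, $dt=dt_1\cdots dt_{n-1}$. For $c>0$, $(c)_{0,k}=1$ and $(c)_{m,k}=c(c+k)\cdots(c+(m-1)k)$ for $m\ge1$. For scalars $a,b>0$, ${}_1F_{1,k}(a;b;x)=\sum_{m=0}^\infty \frac{(a)_{m,k}}{(b)_{m,k}}\frac{x^m}{m!}$, $x\in\mathbb{R}$. The generalized beta $k$-function of the second kind is $$\beta_{\zeta,k}^{(p,q)}(\phi;\eta)=\frac1{k^{n-1}}\int_{E_{n-1}}\prod_{i=1}^n \left[t_i^{\frac{\phi_i}{k}-1}\;{}_1F_{1,k}\!\left(p_i;q_i;-\frac{\eta_i^k}{kt_i}-\zeta_i^k\frac{t_i}{\eta_i^k}\right)\right]dt,$$ and, for the vector $\eta=(\eta_1,\dots,\eta_n)$, $$\beta_k(\phi;\eta)=\frac1{k^{n-1}}\int_{E_{n-1}}\prod_{i=1}^n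 t_i^{\frac{\phi_i}{k}-1}e^{-\frac{\eta_i^k}{kt_i}}\,dt.$$ *)

theory Defs
  imports "HOL-Analysis.Analysis"
begin

definition k_pochhammer :: "real \<Rightarrow> nat \<Rightarrow> real \<Rightarrow> real" where
  "k_pochhammer c m k = (\<Prod>j<m. c + real j * k)"

definition k_hyp1F1 :: "real \<Rightarrow> real \<Rightarrow> real \<Rightarrow> real \<Rightarrow> real" where
  "k_hyp1F1 k a b x = (\<Sum>m. k_pochhammer a m k / k_pochhammer b m k * (x ^ m / fact m))"

text \<open>
  Vectors in \<open>\<real>\<^sup>n\<close> are functions \<open>nat \<Rightarrow> real\<close> whose entries at \<open>1, \<dots>, n\<close> are the coordinates.
  As domain of integration, \<open>\<real>\<^sup>m\<close> is the space of extensional functions on \<open>{1..m}\<close>, with the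
  product of \<open>m\<close> copies of one-dimensional Lebesgue measure.
\<close>

definition corner_simplex :: "nat \<Rightarrow> (nat \<Rightarrow> real) set" where
  "corner_simplex m = {t \<in> {1..m} \<rightarrow>\<^sub>E UNIV. (\<forall>i\<in>{1..m}. 0 \<le> t i) \<and> (\<Sum>i=1..m. t i) \<le> 1}"

text \<open>
  The coordinates of \<open>t \<in> \<real>\<^bsup>n-1\<^esup>\<close> extended by \<open>t\<^sub>n = 1 - (t\<^sub>1 + \<dots> + t\<^bsub>n-1\<^esub>)\<close>.
\<close>

definition ext_coord :: "nat \<Rightarrow> (nat \<Rightarrow> real) \<Rightarrow> nat \<Rightarrow> real" where
  "ext_coord n t i = (if i = n then 1 - (\<Sum>j=1..n-1. t j) else t i)"

text \<open>
  Where some coordinate \<open>t\<^sub>i\<close> vanishes, the integrands below take arbitrary values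
  (\<open>x / 0 = 0\<close>, \<open>0 powr a = 0\<close>); this only concerns a null set.
\<close>

definition k_beta_gen ::
  "nat \<Rightarrow> real \<Rightarrow> (nat \<Rightarrow> real) \<Rightarrow> (nat \<Rightarrow> real) \<Rightarrow> (nat \<Rightarrow> real) \<Rightarrow> (nat \<Rightarrow> real) \<Rightarrow> (nat \<Rightarrow> real) \<Rightarrow> real"
  where
  "k_beta_gen n k \<zeta> p q \<phi> \<eta> =
     1 / k ^ (n - 1) *
     (LINT t:corner_simplex (n - 1)|PiM {1..n-1} (\<lambda>_. lborel).
        (\<Prod>i=1..n. ext_coord n t i powr (\<phi> i / k - 1) *
           k_hyp1F1 k (p i) (q i)
             (- (\<eta> i powr k / (k * ext_coord n t i))
              - \<zeta> i powr k * (ext_coord n t i / \<eta> i powr k))))"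

definition k_beta :: "nat \<Rightarrow> real \<Rightarrow> (nat \<Rightarrow> real) \<Rightarrow> (nat \<Rightarrow> real) \<Rightarrow> real" where
  "k_beta n k \<phi> \<eta> =
     1 / k ^ (n - 1) *
     (LINT t:corner_simplex (n - 1)|PiM {1..n-1} (\<lambda>_. lborel).
        (\<Prod>i=1..n. ext_coord n t i powr (\<phi> i / k - 1) *
           exp (- (\<eta> i powr k / (k * ext_coord n t i)))))"

end

theory Submission
  imports Defs
begin

text \<open>
  Kummer's transformation \<open>e\<^sup>x F(a;b;-x) = F(b-a;b;x)\<close> exhibits \<open>e\<^sup>x F(a;b;-x)\<close> as a power series
  with nonnegative coefficients, hence as an increasing function of \<open>x \<ge> 0\<close>; and it makes
  \<open>F(a;b;-x)\<close> nonnegative, hence decreasing, as its derivative is \<open>-(a/b) F(a+k;b+k;-x)\<close>. Together,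
  \<open>F(a;b;-s-zt) \<ge> e\<^bsup>-s\<^esup> F(a;b;-zt) \<ge> e\<^bsup>-s\<^esup> F(a;b;-z)\<close> for \<open>s, z \<ge> 0\<close> and \<open>0 \<le> t \<le> 1\<close>. With
  \<open>s = \<eta>\<^sub>i\<^sup>k/(k t\<^sub>i)\<close> and \<open>z = \<zeta>\<^sub>i\<^sup>k/\<eta>\<^sub>i\<^sup>k\<close> the integrands compare pointwise. Both are dominated by the
  Dirichlet density, which is integrable by iterating the beta integral.
\<close>

section \<open>The confluent hypergeometric k-function\<close>

lemma k_pochhammer_Suc: "k_pochhammer c (Suc m) k = k_pochhammer c m k * (c + real m * k)"
  by (simp add: k_pochhammer_def)

lemma k_pochhammer_Suc_left: "k_pochhammer c (Suc m) k = c * k_pochhammer (c + k) m k"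
  unfolding k_pochhammer_def
  by (subst prod.lessThan_Suc_shift) (simp add: algebra_simps)

lemma k_pochhammer_0 [simp]: "k_pochhammer c 0 k = 1"
  by (simp add: k_pochhammer_def)

lemma k_pochhammer_pos: "c > 0 \<Longrightarrow> k > 0 \<Longrightarrow> k_pochhammer c m k > 0"
  unfolding k_pochhammer_def by (intro prod_pos) (auto intro!: add_pos_nonneg)

lemma k_pochhammer_mono:
  "0 < a \<Longrightarrow> a \<le> b \<Longrightarrow> k > 0 \<Longrightarrow> k_pochhammer a m k \<le> k_pochhammer b m k"
  unfolding k_pochhammer_def by (intro prod_mono) auto

text \<open>For \<open>a \<le> b\<close> the quotients of Pochhammer symbols lie in [0,1], so the
  exponential series of \<bar>x\<bar> dominates. Absolute convergence is what the Cauchy product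
  below requires.\<close>

lemma summable_k_hyp1F1:
  assumes "0 < a" "a \<le> b" "k > 0"
  shows "summable (\<lambda>m. norm (k_pochhammer a m k / k_pochhammer b m k * (x ^ m / fact m)))"
proof (rule summable_comparison_test')
  show "summable (\<lambda>m. \<bar>x\<bar> ^ m / fact m)"
    using summable_exp[of "\<bar>x\<bar>"] by (simp add: field_simps)
  fix m :: nat
  have "k_pochhammer a m k / k_pochhammer b m k \<le> 1" "0 \<le> k_pochhammer a m k / k_pochhammer b m k"
    using k_pochhammer_mono[OF assms, of m] k_pochhammer_pos[of a k m] k_pochhammer_pos[of b k m]
      assms by auto
  then have "\<bar>k_pochhammer a m k / k_pochhammer b m k\<bar> * (\<bar>x\<bar> ^ m / fact m) \<le> 1 * (\<bar>x\<bar> ^ m / fact m)"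
    by (intro mult_right_mono) auto
  then show "norm (norm (k_pochhammer a m k / k_pochhammer b m k * (x ^ m / fact m)))
      \<le> \<bar>x\<bar> ^ m / fact m"
    by (simp add: abs_mult power_abs)
qed

text \<open>The k-analogue of Chu-Vandermonde for 2F1(-m, a; b; 1). Pascal's rule splits the sum in
  two; the second part shifts \<open>a\<close> and \<open>b\<close> both by \<open>k\<close>, which
  preserves \<open>b - a\<close>. Hence the induction over arbitrary \<open>a\<close> and
  \<open>b\<close>.\<close>

lemma k_chu_vandermonde:
  assumes "b > 0" "k > 0"
  shows "(\<Sum>j\<le>m. real (m choose j) * ((- 1) ^ j * (k_pochhammer a j k / k_pochhammer b j k)))
    = k_pochhammer (b - a) m k / k_pochhammer b m k"
  using assms(1)
proof (induction m arbitrary: a b)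
  case 0
  then show ?case by simp
next
  case (Suc m)
  define u where "u a b j = (- 1) ^ j * (k_pochhammer a j k / k_pochhammer b j k)" for a b :: real and j
  have u_Suc: "u a b (Suc j) = - (a / b) * u (a + k) (b + k) j" for j
    by (simp add: u_def k_pochhammer_Suc_left)
  have pos: "k_pochhammer b m k > 0" "b + real m * k > 0" "k_pochhammer (b + k) m k > 0"
    using Suc.prems \<open>k > 0\<close> by (auto intro!: k_pochhammer_pos add_pos_nonneg)
  have shift: "b * k_pochhammer (b + k) m k = k_pochhammer b m k * (b + real m * k)"
    by (metis k_pochhammer_Suc k_pochhammer_Suc_left)
  have "(\<Sum>j\<le>Suc m. real (Suc m choose j) * u a b j)
      = u a b 0 + (\<Sum>j\<le>m. real (m choose Suc j) * u a b (Suc j)) + (\<Sum>j\<le>m. real (m choose j) * u a b (Suc j))"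
    by (subst sum.atMost_Suc_shift) (simp add: algebra_simps sum.distrib)
  \<comment> \<open>The initial term restores the index 0, and the new top term vanishes because
    \<open>m choose Suc m\<close> is 0.\<close>
  also have "u a b 0 + (\<Sum>j\<le>m. real (m choose Suc j) * u a b (Suc j))
      = (\<Sum>j\<le>Suc m. real (m choose j) * u a b j)"
    by (subst sum.atMost_Suc_shift) simp
  also have "\<dots> = (\<Sum>j\<le>m. real (m choose j) * u a b j)"
    by simp
  also have "\<dots> = k_pochhammer (b - a) m k / k_pochhammer b m k"
    using Suc.IH[OF Suc.prems] by (simp add: u_def)
  also have "(\<Sum>j\<le>m. real (m choose j) * u a b (Suc j))
      = - (a / b) * (\<Sum>j\<le>m. real (m choose j) * u (a + k) (b + k) j)"
    unfolding u_Suc sum_distrib_left by (intro sum.cong) auto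
  also have "(\<Sum>j\<le>m. real (m choose j) * u (a + k) (b + k) j)
      = k_pochhammer (b - a) m k / k_pochhammer (b + k) m k"
    using Suc.IH[of "b + k" "a + k"] Suc.prems \<open>k > 0\<close> by (simp add: u_def)
  also have "k_pochhammer (b - a) m k / k_pochhammer b m k
      + - (a / b) * (k_pochhammer (b - a) m k / k_pochhammer (b + k) m k)
      = k_pochhammer (b - a) m k / k_pochhammer b m k
      - a * k_pochhammer (b - a) m k / (b * k_pochhammer (b + k) m k)"
    by simp
  \<comment> \<open>By \<open>shift\<close> the common denominator is
    \<open>k_pochhammer b (Suc m) k\<close>; the numerator acquires the factor
    \<open>b + real m * k - a\<close>, the next factor of the symbol of
    \<open>b - a\<close>.\<close>
  also have "\<dots> = k_pochhammer (b - a) (Suc m) k / k_pochhammer b (Suc m) k"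
    unfolding shift k_pochhammer_Suc using pos by (simp add: divide_simps) (simp add: algebra_simps)
  finally show ?case
    by (simp add: u_def)
qed

text \<open>Multiply the two series: each coefficient of the Cauchy product is a Chu-Vandermonde
  sum.\<close>

theorem k_kummer_transformation:
  assumes "0 < a" "a < b" "k > 0"
  shows "exp x * k_hyp1F1 k a b (- x) = k_hyp1F1 k (b - a) b x"
proof -
  define f where "f m = k_pochhammer a m k / k_pochhammer b m k * ((- x) ^ m / fact m)" for m
  define g where "g m = x ^ m / fact m" for m
  have exp_eq: "exp x = (\<Sum>m. g m)"
    by (simp add: exp_def g_def field_simps)
  have "summable (\<lambda>m. norm (f m))"
    unfolding f_def by (rule summable_k_hyp1F1) (use assms in auto)
  moreover have "summable (\<lambda>m. norm (g m))"
    using summable_norm_exp[of x] by (simp add: g_def field_simps)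
  ultimately have "(\<Sum>m. f m) * (\<Sum>m. g m) = (\<Sum>m. \<Sum>i\<le>m. f i * g (m - i))"
    by (rule Cauchy_product)
  moreover have "(\<Sum>i\<le>m. f i * g (m - i))
      = k_pochhammer (b - a) m k / k_pochhammer b m k * (x ^ m / fact m)" for m
  proof -
    \<comment> \<open>The binomial coefficient arises from 1/(i! (m-i)!) after extracting
      1/m!.\<close>
    have "f i * g (m - i) = real (m choose i) * ((- 1) ^ i * (k_pochhammer a i k / k_pochhammer b i k))
        * (x ^ m / fact m)" if "i \<le> m" for i
    proof -
      have "x ^ m = x ^ i * x ^ (m - i)"
        using that by (simp flip: power_add)
      then show ?thesis
        using that by (simp add: f_def g_def binomial_fact power_minus[of x] field_simps)
    qed
    then have "(\<Sum>i\<le>m. f i * g (m - i))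
        = (\<Sum>i\<le>m. real (m choose i) * ((- 1) ^ i * (k_pochhammer a i k / k_pochhammer b i k)))
          * (x ^ m / fact m)"
      unfolding sum_distrib_right by (intro sum.cong) auto
    then show ?thesis
      using assms by (subst (asm) k_chu_vandermonde) auto
  qed
  ultimately show ?thesis
    unfolding k_hyp1F1_def exp_eq by (simp only: f_def[symmetric] mult.commute[of "suminf g"])
qed

section \<open>Positivity and monotonicity at negative arguments\<close>

lemma k_hyp1F1_0 [simp]: "k_hyp1F1 k a b 0 = 1"
  unfolding k_hyp1F1_def by (subst suminf_finite[of "{0}"]) auto

lemma k_hyp1F1_mono:
  assumes "0 < a" "a \<le> b" "k > 0" "0 \<le> x" "x \<le> y"
  shows "k_hyp1F1 k a b x \<le> k_hyp1F1 k a b y"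
  unfolding k_hyp1F1_def
proof (rule suminf_le)
  fix m
  have "k_pochhammer a m k > 0" "k_pochhammer b m k > 0"
    using assms by (auto intro!: k_pochhammer_pos)
  then show "k_pochhammer a m k / k_pochhammer b m k * (x ^ m / fact m)
      \<le> k_pochhammer a m k / k_pochhammer b m k * (y ^ m / fact m)"
    using assms by (intro mult_left_mono divide_right_mono power_mono) auto
qed (intro summable_norm_cancel[OF summable_k_hyp1F1] assms)+

lemma exp_mult_k_hyp1F1_mono:
  assumes "0 < a" "a < b" "k > 0" "0 \<le> x" "x \<le> y"
  shows "exp x * k_hyp1F1 k a b (- x) \<le> exp y * k_hyp1F1 k a b (- y)"
  using assms by (simp add: k_kummer_transformation k_hyp1F1_mono)

lemma k_hyp1F1_minus_pos:
  assumes "0 < a" "a < b" "k > 0" "0 \<le> x"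
  shows "k_hyp1F1 k a b (- x) > 0"
proof -
  \<comment> \<open>The increasing product equals 1 at the origin.\<close>
  have "1 \<le> exp x * k_hyp1F1 k a b (- x)"
    using exp_mult_k_hyp1F1_mono[of a b k 0 x] assms by simp
  then have "0 < exp x * k_hyp1F1 k a b (- x)" by linarith
  then show ?thesis by (simp add: zero_less_mult_iff)
qed

text \<open>Differentiate termwise: the index shift peels the first factors \<open>a\<close> and
  \<open>b\<close> off the Pochhammer symbols and raises both parameters by
  \<open>k\<close>.\<close>

lemma DERIV_k_hyp1F1:
  assumes "0 < a" "a \<le> b" "k > 0"
  shows "(k_hyp1F1 k a b has_field_derivative a / b * k_hyp1F1 k (a + k) (b + k) x) (at x)"
proof -
  define c where "c m = k_pochhammer a m k / k_pochhammer b m k / fact m" for m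
  have eq: "k_hyp1F1 k a b = (\<lambda>x. \<Sum>m. c m * x ^ m)"
    by (auto simp: k_hyp1F1_def c_def)
  have sm: "summable (\<lambda>m. c m * y ^ m)" for y
    using summable_norm_cancel[OF summable_k_hyp1F1[OF assms, of y]] by (simp add: c_def)
  have "diffs c m * x ^ m
      = a / b * (k_pochhammer (a + k) m k / k_pochhammer (b + k) m k * (x ^ m / fact m))" for m
    by (simp add: diffs_def c_def k_pochhammer_Suc_left divide_simps del: of_nat_Suc)
  moreover have "summable (\<lambda>m. k_pochhammer (a + k) m k / k_pochhammer (b + k) m k * (x ^ m / fact m))"
    by (rule summable_norm_cancel[OF summable_k_hyp1F1]) (use assms in auto)
  ultimately have "(\<Sum>m. diffs c m * x ^ m) = a / b * k_hyp1F1 k (a + k) (b + k) x"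
    unfolding k_hyp1F1_def by (simp only: suminf_mult)
  then show ?thesis
    unfolding eq using termdiffs_strong_converges_everywhere[OF sm, of x] by simp
qed

lemma k_hyp1F1_minus_antimono:
  assumes "0 < a" "a < b" "k > 0" "0 \<le> x" "x \<le> y"
  shows "k_hyp1F1 k a b (- y) \<le> k_hyp1F1 k a b (- x)"
proof (rule DERIV_nonneg_imp_nondecreasing[where f = "k_hyp1F1 k a b"])
  fix u assume u: "- y \<le> u" "u \<le> - x"
  \<comment> \<open>Here \<open>u \<le> 0\<close>, and the double negation puts the argument into
    the form for which positivity is known.\<close>
  have "0 < k_hyp1F1 k (a + k) (b + k) (- (- u))"
    using assms u by (intro k_hyp1F1_minus_pos) auto
  then have "0 \<le> a / b * k_hyp1F1 k (a + k) (b + k) u"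
    using assms by simp
  then show "\<exists>d. (k_hyp1F1 k a b has_field_derivative d) (at u) \<and> 0 \<le> d"
    using DERIV_k_hyp1F1[of a b k u] assms by auto
qed (use assms in auto)

lemma k_hyp1F1_minus_le_1:
  assumes "0 < a" "a < b" "k > 0" "0 \<le> x"
  shows "k_hyp1F1 k a b (- x) \<le> 1"
  using k_hyp1F1_minus_antimono[of a b k 0 x] assms by simp

lemma exp_mult_k_hyp1F1_le:
  assumes "0 < a" "a < b" "k > 0" "0 \<le> s" "0 \<le> y" "y \<le> z"
  shows "exp (- s) * k_hyp1F1 k a b (- z) \<le> k_hyp1F1 k a b (- s - y)"
proof -
  \<comment> \<open>Both monotonicity results are chained with the common factor
    \<open>exp y\<close>; dividing by \<open>exp (s + y)\<close> at the end leaves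
    \<open>exp (- s)\<close> on the left.\<close>
  have "exp y * k_hyp1F1 k a b (- z) \<le> exp y * k_hyp1F1 k a b (- y)"
    using assms by (intro mult_left_mono k_hyp1F1_minus_antimono) auto
  also have "\<dots> \<le> exp (s + y) * k_hyp1F1 k a b (- (s + y))"
    using assms by (intro exp_mult_k_hyp1F1_mono) auto
  finally show ?thesis
    by (simp add: exp_add exp_minus field_simps)
qed

lemma borel_measurable_k_hyp1F1 [measurable]: "k_hyp1F1 k a b \<in> borel_measurable borel"
  unfolding k_hyp1F1_def[abs_def] by measurable

section \<open>Integrability of the Dirichlet density\<close>

text \<open>Substituting \<open>r * y\<close> for \<open>y\<close> reduces to the beta integral on
  [0,1]. The powers contribute the exponent \<open>a + b - 2\<close>, and the Jacobian adds
  one.\<close>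

lemma nn_integral_scaled_Beta:
  fixes a b r :: real
  assumes "a > 0" "b > 0" "r \<ge> 0"
  shows "(\<integral>\<^sup>+y. ennreal (y powr (a - 1) * (r - y) powr (b - 1)) * indicator {0..r} y \<partial>lborel)
    = ennreal (Beta a b * r powr (a + b - 1))"
proof (cases "r = 0")
  case True
  \<comment> \<open>Since \<open>0 powr c = 0\<close> for every exponent, both sides vanish at
    \<open>r = 0\<close>, even when \<open>a + b - 1\<close> is not positive.\<close>
  have "(\<lambda>y. ennreal (y powr (a - 1) * (r - y) powr (b - 1)) * indicator {0..r} y) = (\<lambda>_. 0)"
    using True by (auto simp: indicator_def)
  then show ?thesis using True by (simp only: nn_integral_0_iff_AE) simp
next
  case False
  then have r: "r > 0" using assms by simp
  have eq: "ennreal ((r * y) powr (a - 1) * (r - r * y) powr (b - 1)) * indicator {0..r} (r * y)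
      = ennreal (r powr (a + b - 2)) * (ennreal (y powr (a - 1) * (1 - y) powr (b - 1)) * indicator {0..1} y)"
    for y
  proof (cases "y \<in> {0..1}")
    case True
    have "r - r * y = r * (1 - y)" by (simp add: algebra_simps)
    then have "(r * y) powr (a - 1) * (r - r * y) powr (b - 1)
        = r powr (a + b - 2) * (y powr (a - 1) * (1 - y) powr (b - 1))"
      using True r by (simp add: powr_mult mult_ac flip: powr_add)
    moreover have "r * y \<in> {0..r}"
      using True r by (auto simp: mult_le_cancel_left1)
    ultimately show ?thesis
      using True by (simp add: ennreal_mult)
  next
    case False
    then have "r * y \<notin> {0..r}"
      using r by (auto simp: zero_le_mult_iff mult_le_cancel_left1)
    then show ?thesis using False by simp
  qed
  have "(\<integral>\<^sup>+y. ennreal (y powr (a - 1) * (r - y) powr (b - 1)) * indicator {0..r} y \<partial>lborel)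
      = ennreal r * (\<integral>\<^sup>+y. ennreal ((r * y) powr (a - 1) * (r - r * y) powr (b - 1)) * indicator {0..r} (r * y) \<partial>lborel)"
    using r by (subst nn_integral_real_affine[where t = 0 and c = r]) auto
  also have "\<dots> = ennreal r * (ennreal (r powr (a + b - 2)) *
      (\<integral>\<^sup>+y. ennreal (y powr (a - 1) * (1 - y) powr (b - 1)) * indicator {0..1} y \<partial>lborel))"
    unfolding eq by (subst nn_integral_cmult) auto
  also have "(\<integral>\<^sup>+y. ennreal (y powr (a - 1) * (1 - y) powr (b - 1)) * indicator {0..1} y \<partial>lborel)
      = ennreal (Beta a b)"
    using assms by (intro nn_integral_has_integral_lebesgue' has_integral_Beta_real) auto
  also have "ennreal r * (ennreal (r powr (a + b - 2)) * ennreal (Beta a b))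
      = ennreal (r * r powr (a + b - 2) * Beta a b)"
    using r by (simp add: ennreal_mult' ennreal_mult'' mult_ac)
  also have "r * r powr (a + b - 2) = r powr (a + b - 1)"
    using r by (simp add: powr_mult_base)
  finally show ?thesis by (simp add: mult.commute)
qed

text \<open>
  The exponent \<open>b\<close> of the dependent coordinate is arbitrary: integrating out the coordinate \<open>i\<close>
  replaces \<open>b\<close> by \<open>a\<^sub>i + b\<close>.
\<close>

lemma nn_integral_Dirichlet_finite:
  fixes a :: "'i \<Rightarrow> real" and b :: real
  assumes "finite I" "\<And>i. i \<in> I \<Longrightarrow> a i > 0" "b > 0"
  shows "(\<integral>\<^sup>+t. ennreal (if (\<forall>i\<in>I. 0 \<le> t i) \<and> sum t I \<le> 1
      then (\<Prod>i\<in>I. t i powr (a i - 1)) * (1 - sum t I) powr (b - 1) else 0)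
      \<partial>PiM I (\<lambda>_. lborel)) < \<infinity>"
  using assms
proof (induction I arbitrary: b rule: finite_induct)
  case empty
  then show ?case by (simp add: nn_integral_count_space_finite space_PiM PiM_empty)
next
  case (insert i I)
  interpret product_sigma_finite "\<lambda>_. lborel :: real measure"
    by standard
  define D where "D J b t = (if (\<forall>i\<in>J. 0 \<le> t i) \<and> sum t J \<le> 1
      then (\<Prod>i\<in>J. t i powr (a i - 1)) * (1 - sum t J) powr (b - 1) else 0)" for J b t
  have meas [measurable]: "(\<lambda>t. ennreal (D J b t)) \<in> borel_measurable (PiM J (\<lambda>_. lborel))"
    if "finite J" for J b
    using that unfolding D_def by measurable
  have ai: "a i > 0" using insert.prems by simp
  \<comment> \<open>The slice over a point \<open>t\<close> of the smaller simplex is [0,r], where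
    \<open>r\<close> is the remaining mass \<open>1 - sum t I\<close>; the scaled beta integral
    evaluates it.\<close>
  have inner: "(\<integral>\<^sup>+y. ennreal (D (insert i I) b (t(i := y))) \<partial>lborel)
      = ennreal (Beta (a i) b) * ennreal (D I (a i + b) t)" for t
  proof (cases "(\<forall>j\<in>I. 0 \<le> t j) \<and> sum t I \<le> 1")
    case True
    define P where "P = (\<Prod>j\<in>I. t j powr (a j - 1))"
    define r where "r = 1 - sum t I"
    have P: "P \<ge> 0" and r: "r \<ge> 0"
      using True by (auto simp: P_def r_def intro: prod_nonneg)
    have "sum (t(i := y)) I = sum t I" "(\<Prod>j\<in>I. (t(i := y)) j powr (a j - 1)) = P" for y
      using insert.hyps unfolding P_def by (auto intro!: sum.cong prod.cong)
    moreover have "(\<forall>j\<in>I. 0 \<le> (t(i := y)) j)" for y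
      using True insert.hyps by auto
    ultimately have "D (insert i I) b (t(i := y))
        = P * (y powr (a i - 1) * (r - y) powr (b - 1)) * indicator {0..r} y" for y
      using insert.hyps by (auto simp: D_def r_def indicator_def algebra_simps)
    then have "ennreal (D (insert i I) b (t(i := y)))
        = ennreal P * (ennreal (y powr (a i - 1) * (r - y) powr (b - 1)) * indicator {0..r} y)" for y
      using P by (auto simp: indicator_def ennreal_mult')
    then have "(\<integral>\<^sup>+y. ennreal (D (insert i I) b (t(i := y))) \<partial>lborel)
        = ennreal P * (\<integral>\<^sup>+y. ennreal (y powr (a i - 1) * (r - y) powr (b - 1)) * indicator {0..r} y \<partial>lborel)"
      by (simp add: nn_integral_cmult)
    also have "\<dots> = ennreal P * ennreal (Beta (a i) b * r powr (a i + b - 1))"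
      using ai insert.prems r by (subst nn_integral_scaled_Beta) auto
    also have "\<dots> = ennreal (Beta (a i) b * (P * r powr (a i + b - 1)))"
      using P by (simp add: mult_ac flip: ennreal_mult')
    also have "\<dots> = ennreal (Beta (a i) b) * ennreal (P * r powr (a i + b - 1))"
      using P by (intro ennreal_mult'') auto
    also have "P * r powr (a i + b - 1) = D I (a i + b) t"
      using True by (simp add: D_def P_def r_def)
    finally show ?thesis .
  next
    case False
    \<comment> \<open>Outside the smaller simplex the slice is empty: a nonnegative \<open>y\<close>
      cannot bring a sum above 1 back below it.\<close>
    have "D (insert i I) b (t(i := y)) = 0" for y
    proof -
      have "sum (t(i := y)) I = sum t I" "(\<forall>j\<in>I. 0 \<le> (t(i := y)) j) \<longleftrightarrow> (\<forall>j\<in>I. 0 \<le> t j)"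
        using insert.hyps by (auto intro!: sum.cong split: if_splits)
      then show ?thesis
        using False insert.hyps by (auto simp: D_def)
    qed
    moreover have "D I (a i + b) t = 0"
      unfolding D_def using False by (rule if_not_P)
    ultimately show ?thesis by simp
  qed
  have "(\<integral>\<^sup>+t. ennreal (D (insert i I) b t) \<partial>PiM (insert i I) (\<lambda>_. lborel))
      = (\<integral>\<^sup>+t. ennreal (Beta (a i) b) * ennreal (D I (a i + b) t) \<partial>PiM I (\<lambda>_. lborel))"
    using insert.hyps by (subst product_nn_integral_insert) (auto simp: inner)
  also have "\<dots> = ennreal (Beta (a i) b) * (\<integral>\<^sup>+t. ennreal (D I (a i + b) t) \<partial>PiM I (\<lambda>_. lborel))"
    using insert.hyps by (intro nn_integral_cmult) auto
  also have "\<dots> < \<infinity>"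
    using insert.IH[of "a i + b"] insert.prems ai by (simp add: ennreal_mult_less_top D_def)
  finally show ?case
    unfolding D_def .
qed

section \<open>Measurability and integrability on the simplex\<close>

lemma corner_simplex_sets [measurable]: "corner_simplex m \<in> sets (PiM {1..m} (\<lambda>_. lborel))"
proof -
  have "corner_simplex m = {t \<in> space (PiM {1..m} (\<lambda>_. lborel)).
      (\<forall>i\<in>{1..m}. 0 \<le> t i) \<and> (\<Sum>i=1..m. t i) \<le> 1}"
    by (auto simp: corner_simplex_def space_PiM)
  also have "\<dots> \<in> sets (PiM {1..m} (\<lambda>_. lborel))"
    by measurable
  finally show ?thesis .
qed

lemma measurable_ext_coord [measurable]:
  assumes "i \<in> {1..n}"
  shows "(\<lambda>t. ext_coord n t i) \<in> borel_measurable (PiM {1..n-1} (\<lambda>_. lborel))"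
proof (cases "i = n")
  case False
  then have "i \<in> {1..n-1}" using assms by auto
  then show ?thesis using False unfolding ext_coord_def by simp
qed (simp add: ext_coord_def)

lemma ext_coord_bounds:
  assumes "t \<in> corner_simplex (n - 1)" "i \<in> {1..n}"
  shows "0 \<le> ext_coord n t i" "ext_coord n t i \<le> 1"
proof -
  have t: "\<And>j. j \<in> {1..n-1} \<Longrightarrow> 0 \<le> t j" "(\<Sum>j=1..n-1. t j) \<le> 1"
    using assms by (auto simp: corner_simplex_def)
  have "0 \<le> (\<Sum>j=1..n-1. t j)"
    using t by (intro sum_nonneg) auto
  moreover have "0 \<le> t i \<and> t i \<le> 1" if "i \<noteq> n"
  proof -
    have "i \<in> {1..n-1}" using assms that by auto
    then show ?thesis
      using t member_le_sum[of i "{1..n-1}" t] by fastforce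
  qed
  ultimately show "0 \<le> ext_coord n t i" "ext_coord n t i \<le> 1"
    using t by (auto simp: ext_coord_def)
qed

text \<open>Weights bounded by 1 leave the Dirichlet density as a majorant. The weights
  \<open>G i\<close> allow one argument to serve both the exponential and the hypergeometric
  integrand.\<close>

lemma set_integrable_Dirichlet_weighted:
  assumes "n \<ge> 1" "\<And>i. i \<in> {1..n} \<Longrightarrow> a i > 0"
    and meas: "\<And>i. i \<in> {1..n} \<Longrightarrow> G i \<in> borel_measurable borel"
    and bound: "\<And>i x. i \<in> {1..n} \<Longrightarrow> 0 \<le> x \<Longrightarrow> x \<le> 1 \<Longrightarrow> \<bar>G i x\<bar> \<le> 1"
  shows "set_integrable (PiM {1..n-1} (\<lambda>_. lborel)) (corner_simplex (n - 1))
    (\<lambda>t. \<Prod>i=1..n. ext_coord n t i powr (a i - 1) * G i (ext_coord n t i))"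
  unfolding set_integrable_def integrable_iff_bounded
proof
  let ?M = "PiM {1..n-1} (\<lambda>_. lborel :: real measure)"
  have G_meas: "(\<lambda>t. G i (ext_coord n t i)) \<in> borel_measurable ?M" if "i \<in> {1..n}" for i
    using measurable_compose[OF measurable_ext_coord[OF that] meas[OF that]] .
  show "(\<lambda>t. indicator (corner_simplex (n - 1)) t *\<^sub>R
      (\<Prod>i=1..n. ext_coord n t i powr (a i - 1) * G i (ext_coord n t i))) \<in> borel_measurable ?M"
    by (intro borel_measurable_scaleR borel_measurable_indicator corner_simplex_sets
        borel_measurable_prod borel_measurable_times powr_real_measurable measurable_ext_coord
        G_meas borel_measurable_const)
  \<comment> \<open>Coordinate \<open>n\<close> is split off as the dependent one;
    \<open>a n\<close> takes the role of the exponent \<open>b\<close> in the Dirichlet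
    integral.\<close>
  have split: "{1..n} = insert n {1..n-1}" "n \<notin> {1..n-1}"
    using assms(1) by auto
  have "norm (indicator (corner_simplex (n - 1)) t *\<^sub>R
        (\<Prod>i=1..n. ext_coord n t i powr (a i - 1) * G i (ext_coord n t i)))
      \<le> (if (\<forall>i\<in>{1..n-1}. 0 \<le> t i) \<and> sum t {1..n-1} \<le> 1
        then (\<Prod>i\<in>{1..n-1}. t i powr (a i - 1)) * (1 - sum t {1..n-1}) powr (a n - 1) else 0)" for t
  proof (cases "t \<in> corner_simplex (n - 1)")
    case True
    have "norm (\<Prod>i=1..n. ext_coord n t i powr (a i - 1) * G i (ext_coord n t i))
        \<le> (\<Prod>i=1..n. ext_coord n t i powr (a i - 1))"
      unfolding prod_norm[symmetric]
      using bound ext_coord_bounds[OF True] by (intro prod_mono) (auto simp: abs_mult intro!: mult_left_le)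
    also have "\<dots> = (1 - sum t {1..n-1}) powr (a n - 1) * (\<Prod>i\<in>{1..n-1}. ext_coord n t i powr (a i - 1))"
      unfolding split(1) by (subst prod.insert) (use split in \<open>auto simp: ext_coord_def\<close>)
    also have "(\<Prod>i\<in>{1..n-1}. ext_coord n t i powr (a i - 1)) = (\<Prod>i\<in>{1..n-1}. t i powr (a i - 1))"
      by (intro prod.cong) (auto simp: ext_coord_def)
    finally show ?thesis
      using True by (auto simp: corner_simplex_def mult.commute)
  next
    case False
    then show ?thesis by (auto intro!: mult_nonneg_nonneg prod_nonneg)
  qed
  then have "(\<integral>\<^sup>+t. ennreal (norm (indicator (corner_simplex (n - 1)) t *\<^sub>R
        (\<Prod>i=1..n. ext_coord n t i powr (a i - 1) * G i (ext_coord n t i)))) \<partial>?M)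
      \<le> (\<integral>\<^sup>+t. ennreal (if (\<forall>i\<in>{1..n-1}. 0 \<le> t i) \<and> sum t {1..n-1} \<le> 1
        then (\<Prod>i\<in>{1..n-1}. t i powr (a i - 1)) * (1 - sum t {1..n-1}) powr (a n - 1) else 0) \<partial>?M)"
    by (intro nn_integral_mono ennreal_leI) simp
  also have "\<dots> < \<infinity>"
    using assms by (intro nn_integral_Dirichlet_finite) auto
  finally show "(\<integral>\<^sup>+t. ennreal (norm (indicator (corner_simplex (n - 1)) t *\<^sub>R
        (\<Prod>i=1..n. ext_coord n t i powr (a i - 1) * G i (ext_coord n t i)))) \<partial>?M) < \<infinity>" .
qed

section \<open>The beta k-functions\<close>

text \<open>A nonnegative integrand with zero integral vanishes almost everywhere, but
  \<open>f\<close> is positive on a box of positive measure. Strict positivity is asked only where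
  all coordinates are positive, as \<open>0 powr c = 0\<close> can make integrands vanish on the
  boundary.\<close>

lemma set_integral_corner_simplex_pos:
  fixes f :: "(nat \<Rightarrow> real) \<Rightarrow> real"
  assumes "n \<ge> 1"
    and int: "set_integrable (PiM {1..n-1} (\<lambda>_. lborel)) (corner_simplex (n - 1)) f"
    and nonneg: "\<And>t. t \<in> corner_simplex (n - 1) \<Longrightarrow> 0 \<le> f t"
    and pos: "\<And>t. t \<in> corner_simplex (n - 1) \<Longrightarrow> (\<And>i. i \<in> {1..n} \<Longrightarrow> 0 < ext_coord n t i) \<Longrightarrow> 0 < f t"
  shows "(LINT t:corner_simplex (n - 1)|PiM {1..n-1} (\<lambda>_. lborel). f t) > 0"
proof -
  interpret product_sigma_finite "\<lambda>_. lborel :: real measure"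
    by standard
  let ?M = "PiM {1..n-1} (\<lambda>_. lborel :: real measure)"
  let ?g = "\<lambda>t. indicator (corner_simplex (n - 1)) t *\<^sub>R f t"
  \<comment> \<open>With side 1/n the \<open>n - 1\<close> free coordinates sum to at most (n-1)/n <
    1, so the dependent coordinate stays positive.\<close>
  define B where "B = PiE {1..n-1} (\<lambda>_. {0<..<1 / real n})"
  have B_sets: "B \<in> sets ?M"
    unfolding B_def by (intro sets_PiM_I_finite) auto
  have "emeasure ?M B = ennreal (1 / real n) ^ (n - 1)"
    unfolding B_def using assms(1) by (subst emeasure_PiM) auto
  then have B_pos: "emeasure ?M B \<noteq> 0"
    using assms(1) by (simp add: ennreal_eq_0_iff)
  have g_pos: "0 < ?g t" if "t \<in> B" for t
  proof -
    have ti: "0 < t i" "t i < 1 / real n" if "i \<in> {1..n-1}" for i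
      using \<open>t \<in> B\<close> that by (auto simp: B_def)
    have "(\<Sum>i=1..n-1. t i) \<le> (\<Sum>i=1..n-1. 1 / real n)"
      using ti by (intro sum_mono less_imp_le) auto
    also have "\<dots> < 1"
      using assms(1) by (simp add: field_simps)
    finally have S: "(\<Sum>i=1..n-1. t i) < 1" .
    have "t \<in> corner_simplex (n - 1)"
      using ti S \<open>t \<in> B\<close> by (auto simp: corner_simplex_def B_def PiE_def intro: less_imp_le)
    moreover have "0 < ext_coord n t i" if "i \<in> {1..n}" for i
      using ti[of i] S that by (auto simp: ext_coord_def)
    ultimately show ?thesis
      using pos by simp
  qed
  have g: "integrable ?M ?g" "\<And>t. 0 \<le> ?g t"
    using int nonneg by (auto simp: set_integrable_def indicator_def)
  have "integral\<^sup>L ?M ?g \<noteq> 0"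
  proof
    assume "integral\<^sup>L ?M ?g = 0"
    then have "AE t in ?M. ?g t = 0"
      using integral_nonneg_eq_0_iff_AE[OF g(1)] g(2) by simp
    then have "AE t in ?M. t \<notin> B"
      by eventually_elim (use g_pos in fastforce)
    moreover have "{t \<in> space ?M. \<not> t \<notin> B} = B"
      using sets.sets_into_space[OF B_sets] by auto
    ultimately show False
      using AE_iff_measurable[of B ?M "\<lambda>t. t \<notin> B"] B_sets B_pos by simp
  qed
  moreover have "integral\<^sup>L ?M ?g \<ge> 0"
    using g(2) by (intro Bochner_Integration.integral_nonneg)
  ultimately show ?thesis
    unfolding set_lebesgue_integral_def by linarith
qed

section \<open>Comparison of the two beta integrals\<close>

theorem theorem2p10:
  fixes n :: nat and k :: real and \<phi> \<eta> p q \<zeta> :: "nat \<Rightarrow> real"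
  assumes "n \<ge> 2" and "k > 0"
    and "\<forall>i\<in>{1..n}. \<phi> i > 0"
    and "\<forall>i\<in>{1..n}. \<eta> i > 0"
    and "\<forall>i\<in>{1..n}. p i > 0"
    and "\<forall>i\<in>{1..n}. q i - p i > 0"
    and "\<forall>i\<in>{1..n}. \<zeta> i \<ge> 0"
  shows "k_beta_gen n k \<zeta> p q \<phi> \<eta> / k_beta n k \<phi> \<eta>
           \<ge> (\<Prod>i=1..n. k_hyp1F1 k (p i) (q i) (- (\<zeta> i powr k / \<eta> i powr k)))"
proof -
  let ?M = "PiM {1..n-1} (\<lambda>_. lborel :: real measure)" and ?A = "corner_simplex (n - 1)"
  define s where "s i x = \<eta> i powr k / (k * x)" for i x
  define z where "z i = \<zeta> i powr k / \<eta> i powr k" for i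
  define E where "E i x = exp (- s i x)" for i x
  define F where "F i x = k_hyp1F1 k (p i) (q i) (- s i x - \<zeta> i powr k * (x / \<eta> i powr k))" for i x
  define C where "C = (\<Prod>i=1..n. k_hyp1F1 k (p i) (q i) (- z i))"
  define e where "e t = (\<Prod>i=1..n. ext_coord n t i powr (\<phi> i / k - 1) * E i (ext_coord n t i))" for t
  define f where "f t = (\<Prod>i=1..n. ext_coord n t i powr (\<phi> i / k - 1) * F i (ext_coord n t i))" for t

  have pq: "0 < p i" "p i < q i" if "i \<in> {1..n}" for i
    using assms that by auto
  \<comment> \<open>This includes \<open>x = 0\<close>, where division by zero gives
    \<open>s i 0 = 0\<close>; the pointwise estimates therefore hold on the whole closed
    simplex.\<close>
  have s: "0 \<le> s i x" if "0 \<le> x" for i x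
    using that \<open>k > 0\<close> by (simp add: s_def)
  have z: "0 \<le> z i" for i
    by (simp add: z_def)
  have F_eq: "F i x = k_hyp1F1 k (p i) (q i) (- (s i x + z i * x))" for i x
    unfolding F_def z_def by (simp add: algebra_simps)
  have F_bounds: "0 < F i x" "F i x \<le> 1" if "i \<in> {1..n}" "0 \<le> x" for i x
    unfolding F_eq using that pq[OF that(1)] s[OF that(2)] z \<open>k > 0\<close>
    by (intro k_hyp1F1_minus_pos k_hyp1F1_minus_le_1 add_nonneg_nonneg mult_nonneg_nonneg; simp)+
  have E_bounds: "0 < E i x" "E i x \<le> 1" if "0 \<le> x" for i x
    using s[OF that] by (auto simp: E_def)
  \<comment> \<open>Apply the key inequality with \<open>y = z i * x\<close>, which is at most
    \<open>z i\<close> because \<open>x \<le> 1\<close>.\<close>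
  have EF: "k_hyp1F1 k (p i) (q i) (- z i) * E i x \<le> F i x" if "i \<in> {1..n}" "0 \<le> x" "x \<le> 1" for i x
    using exp_mult_k_hyp1F1_le[OF pq[OF that(1)] \<open>k > 0\<close> s[OF that(2)], of "z i * x" "z i"]
      mult_left_le[OF that(3) z[of i]] that z by (simp add: E_def F_eq mult.commute)

  have [measurable]: "E i \<in> borel_measurable borel" "F i \<in> borel_measurable borel" for i
    unfolding E_def F_def s_def by measurable
  have e_int: "set_integrable ?M ?A e"
    unfolding e_def using assms E_bounds
    by (intro set_integrable_Dirichlet_weighted) (auto simp: abs_of_pos)
  have f_int: "set_integrable ?M ?A f"
    unfolding f_def using assms F_bounds
    by (intro set_integrable_Dirichlet_weighted) (auto simp: abs_of_pos)

  \<comment> \<open>Strict positivity permits the final division by this integral.\<close>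
  have e_pos: "(LINT t:?A|?M. e t) > 0"
  proof (rule set_integral_corner_simplex_pos[OF _ e_int])
    show "0 \<le> e t" if "t \<in> ?A" for t
      unfolding e_def using ext_coord_bounds[OF that] E_bounds
      by (intro prod_nonneg mult_nonneg_nonneg) (auto intro: less_imp_le)
    show "0 < e t" if "\<And>i. i \<in> {1..n} \<Longrightarrow> 0 < ext_coord n t i" for t
      unfolding e_def
    proof (intro prod_pos)
      fix i assume "i \<in> {1..n}"
      from that[OF this] show "0 < ext_coord n t i powr (\<phi> i / k - 1) * E i (ext_coord n t i)"
        using E_bounds(1)[of "ext_coord n t i" i] by simp
    qed
  qed (use assms in auto)

  have "C * (LINT t:?A|?M. e t) = (LINT t:?A|?M. C * e t)"
    by simp
  also have "\<dots> \<le> (LINT t:?A|?M. f t)"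
  proof (rule set_integral_mono)
    show "set_integrable ?M ?A (\<lambda>t. C * e t)"
      using e_int by simp
    show "C * e t \<le> f t" if "t \<in> ?A" for t
      \<comment> \<open>The constant \<open>C\<close> is distributed over the coordinates, so the
        products compare factor by factor.\<close>
      unfolding C_def e_def f_def prod.distrib[symmetric]
    proof (rule prod_mono, intro conjI)
      fix i assume i: "i \<in> {1..n}"
      note b = ext_coord_bounds[OF that i]
      show "0 \<le> k_hyp1F1 k (p i) (q i) (- z i) * (ext_coord n t i powr (\<phi> i / k - 1) * E i (ext_coord n t i))"
        using k_hyp1F1_minus_pos[OF pq[OF i] \<open>k > 0\<close> z] E_bounds[OF b(1)]
        by (intro mult_nonneg_nonneg) (auto intro: less_imp_le)
      show "k_hyp1F1 k (p i) (q i) (- z i) * (ext_coord n t i powr (\<phi> i / k - 1) * E i (ext_coord n t i))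
          \<le> ext_coord n t i powr (\<phi> i / k - 1) * F i (ext_coord n t i)"
        using mult_left_mono[OF EF[OF i b], of "ext_coord n t i powr (\<phi> i / k - 1)"]
        by (simp add: mult_ac)
    qed
  qed (rule f_int)
  finally have "C \<le> (LINT t:?A|?M. f t) / (LINT t:?A|?M. e t)"
    using e_pos by (simp add: pos_le_divide_eq)
  \<comment> \<open>The common prefactor \<open>1 / k ^ (n - 1)\<close> is nonzero and
    cancels.\<close>
  also have "\<dots> = k_beta_gen n k \<zeta> p q \<phi> \<eta> / k_beta n k \<phi> \<eta>"
    unfolding k_beta_gen_def k_beta_def e_def f_def E_def F_def s_def
    using \<open>k > 0\<close> by simp
  finally show ?thesis
    unfolding C_def z_def .
qed

end
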